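(* There is no competitive bipartite tournament.
   Context: A bipartite tournament is an orientation of a (finite) complete bipartite graph $K_{m,n}$ with $m,n\geq 1$, where an orientation of a graph $G$ is a digraph $D$ on $V(G)$ with no loops, no multiple arcs and no directed $2$-cycles, whose underlying graph is $G$. A digraph $D$ is competitive if every pair of distinct vertices $x,y$ has a common out-neighbor, i.e. there is a vertex $z$ with $(x,z),(y,z)\in A(D)$. *)

theory Defs
  imports "Graph_Theory.Kuratowski"
begin

text \<open>
  Undirected graphs are symmetric digraphs, as in the Graph_Theory entry. In particular
  \<^const>\<open>mk_symmetric\<close> yields the underlying graph of a digraph. Its vertex set is that
  of the digraph, so an orientation of \<open>G\<close> has the same vertices as \<open>G\<close>. The locale predicate
  \<^const>\<open>digraph\<close> contributes finiteness and the absence of loops and of multiple arcs.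
\<close>

definition orientation :: "('a, 'b) pre_digraph \<Rightarrow> 'a pair_pre_digraph \<Rightarrow> bool" where
  "orientation D G \<longleftrightarrow>
     digraph D \<and> (\<forall>u v. \<not> (u \<rightarrow>\<^bsub>D\<^esub> v \<and> v \<rightarrow>\<^bsub>D\<^esub> u)) \<and> mk_symmetric D = G"

definition bipartite_tournament :: "('a, 'b) pre_digraph \<Rightarrow> bool" where
  "bipartite_tournament D \<longleftrightarrow>
     (\<exists>m n G. m \<ge> 1 \<and> n \<ge> 1 \<and> K\<^bsub>m,n\<^esub> (with_proj G) \<and> orientation D G)"

definition competitive :: "('a, 'b) pre_digraph \<Rightarrow> bool" where
  "competitive D \<longleftrightarrow>
     (\<forall>x\<in>verts D. \<forall>y\<in>verts D. x \<noteq> y \<longrightarrow> (\<exists>z\<in>verts D. x \<rightarrow>\<^bsub>D\<^esub> z \<and> y \<rightarrow>\<^bsub>D\<^esub> z))"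

end

theory Submission
  imports Defs
begin

text \<open>A common out-neighbor of two vertices is adjacent to both in the underlying graph. In a
  complete bipartite graph, vertices taken from opposite parts have no common neighbor, since it
  would lie in both parts. Such a pair exists because both parts are nonempty.\<close>

theorem corollary2p3:
  shows "\<not> (\<exists>D :: ('a, 'b) pre_digraph. bipartite_tournament D \<and> competitive D)"
proof
  assume "\<exists>D :: ('a, 'b) pre_digraph. bipartite_tournament D \<and> competitive D"
  then obtain D :: "('a, 'b) pre_digraph" and m n :: nat where "m \<ge> 1" "n \<ge> 1"
    and K: "K\<^bsub>m,n\<^esub> (with_proj (mk_symmetric D))" and comp: "competitive D"
    by (auto simp: bipartite_tournament_def orientation_def)
  from K obtain U V where UV: "verts D = U \<union> V" "U \<inter> V = {}" "card U = m" "card V = n"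
    and arcs: "parcs (mk_symmetric D) = U \<times> V \<union> V \<times> U"
    by (auto simp: complete_bipartite_digraph_pair_def)
  \<comment> \<open>\<open>mk_symmetric\<close> only adds reversed arcs, so each arc of
    \<open>D\<close> joins the two parts.\<close>
  have adj: "(x, z) \<in> U \<times> V \<union> V \<times> U" if "x \<rightarrow>\<^bsub>D\<^esub> z" for x z
    using that unfolding arcs [symmetric] by (auto simp: parcs_mk_symmetric arcs_ends_conv)
  from UV \<open>m \<ge> 1\<close> \<open>n \<ge> 1\<close> have "U \<noteq> {}" "V \<noteq> {}"
    by auto
  then obtain u v where uv: "u \<in> U" "v \<in> V"
    by blast
  then have "u \<noteq> v"
    using UV by blast
  then obtain z where "u \<rightarrow>\<^bsub>D\<^esub> z" "v \<rightarrow>\<^bsub>D\<^esub> z"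
    using comp uv UV unfolding competitive_def by blast
  \<comment> \<open>Adjacency to \<open>u\<close> puts \<open>z\<close> in \<open>V\<close>, adjacency to \<open>v\<close> puts it in \<open>U\<close>.\<close>
  then show False
    using adj uv UV by blast
qed

end
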